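(* Let $A\subset\mathbb{R}^n$ be a Borel set with $\dim A>1$ and $\dim_F A\geq u$ for some $u\in(0,1]$. Then for every $a,x\in\mathbb{R}^n$ with $x\neq a$, $$\dim\big(\Pi_x^a(A)\big)\geq u.$$
   Context: Here $\dim$ denotes Hausdorff dimension. For $A\subset\mathbb{R}^n$ and $a,x\in\mathbb{R}^n$, $$\Pi_x^a(A):=\{\alpha\in\mathbb{R} : (a-x)\cdot y=\alpha \text{ for some } y\in A\}.$$ For a Borel set $A\subset\mathbb{R}^n$, $\mathcal{M}(A)$ denotes the space of Borel probability measures supported on $A$, and the Fourier dimension of $A$ is $$\dim_F A:=\sup\{s : \exists\,\mu\in\mathcal{M}(A)\text{ with } |\hat\mu(\xi)|\lesssim|\xi|^{-s/2}\ \text{ for all } \xi\in\mathbb{R}^n\},$$ where $\hat\mu(\xi)=\int e^{-2\pi i\xi\cdot x}\,d\mu(x)$ and $\lesssim$ means inequality up to a constant independent of $\xi$. *)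

theory Defs
  imports "HOL-Probability.Probability"
begin

(* The summand diam(U)^s of the Hausdorff measure, with the usual conventions at s = 0
   (diam({})^0 = 0 and diam(U)^0 = 1 otherwise).  The case distinction is needed because
   0 powr 0 = 0, which would give singletons weight 0 at s = 0. *)
definition diam_powr :: "real \<Rightarrow> 'a::metric_space set \<Rightarrow> ennreal" where
  "diam_powr s U = (if U = {} then 0 else if s = 0 then 1 else ennreal (diameter U powr s))"

(* The boundedness requirement excludes sets of infinite diameter, on which the real-valued
   diameter is unspecified. *)
definition hausdorff_content :: "real \<Rightarrow> real \<Rightarrow> 'a::metric_space set \<Rightarrow> ennreal" where
  "hausdorff_content s \<delta> A =
     (INF U \<in> {U :: nat \<Rightarrow> 'a set. A \<subseteq> (\<Union>i. U i) \<and> (\<forall>i. bounded (U i) \<and> diameter (U i) \<le> \<delta>)}.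
        \<Sum>i. diam_powr s (U i))"

definition hausdorff_measure :: "real \<Rightarrow> 'a::metric_space set \<Rightarrow> ennreal" where
  "hausdorff_measure s A = (SUP \<delta> \<in> {0<..}. hausdorff_content s \<delta> A)"

definition hausdorff_dim :: "'a::metric_space set \<Rightarrow> ereal" where
  "hausdorff_dim A = (INF s \<in> {s. 0 \<le> s \<and> hausdorff_measure s A = 0}. ereal s)"

(* "Supported on A" is read as "concentrated on A", i.e. mu(A) = 1. *)
definition prob_measures_on :: "'a::topological_space set \<Rightarrow> 'a measure set" where
  "prob_measures_on A = {\<mu>. sets \<mu> = sets borel \<and> prob_space \<mu> \<and> emeasure \<mu> A = 1}"

definition fourier_transform :: "'a::euclidean_space measure \<Rightarrow> 'a \<Rightarrow> complex" where
  "fourier_transform \<mu> \<xi> =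
     (\<integral>x. exp (- 2 * complex_of_real pi * \<i> * complex_of_real (\<xi> \<bullet> x)) \<partial>\<mu>)"

(* The exponent s is not bounded above, so the supremum is taken in the extended reals.
   The point xi = 0 is left out: for s > 0 the bound there is mathematically void, the right-hand
   side being infinite, whereas Isabelle has 0 powr (- s / 2) = 0. *)
definition fourier_dim :: "'a::euclidean_space set \<Rightarrow> ereal" where
  "fourier_dim A =
     (SUP s \<in> {s :: real. \<exists>\<mu> \<in> prob_measures_on A. \<exists>C. \<forall>\<xi>. \<xi> \<noteq> 0 \<longrightarrow>
                 cmod (fourier_transform \<mu> \<xi>) \<le> C * norm \<xi> powr (- s / 2)}. ereal s)"

definition Pi_proj :: "'a::euclidean_space \<Rightarrow> 'a \<Rightarrow> 'a set \<Rightarrow> real set" where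
  "Pi_proj a x A = {\<alpha>. \<exists>y\<in>A. (a - x) \<bullet> y = \<alpha>}"

end

(* The push-forward nu of a measure with decaying Fourier transform under y |-> (a - x) . y has
   |char nu t|^2 bounded by a multiple of |t|^(-s).  Integrating |char nu (z / r)|^2 against a
   standard Gaussian in z and using Parseval gives int nu(cball x r) dnu(x) <= K r^s for s < 1.
   Summing over dyadic r, nu(cball x r) <= c r^t holds for t < s on a set of positive measure,
   and the mass distribution principle applies.  Going through the L^2 average matters: the decay
   alone gives a uniform ball condition with exponent s/2 only. *)
theory Submission imports Defs begin

section \<open>Characteristic functions and a Gaussian moment\<close>

text \<open>Fubini for the bounded kernel \<open>iexp (z * x)\<close>, which is symmetric in its
  variables. With \<open>N\<close> Gaussian this is the form of Parseval used below.\<close>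

lemma (in real_distribution) char_integral_commute:
  assumes "real_distribution N"
  shows "(CLINT z|N. char M z) = (CLINT x|M. char N x)"
proof -
  interpret N: real_distribution N by fact
  interpret pair_prob_space N M ..
  have "integrable (N \<Otimes>\<^sub>M M) (\<lambda>(z, x). iexp (z * x))"
    by (rule integrable_const_bound[where B = 1]) (auto simp: split_beta)
  from Fubini_integral[OF this] show ?thesis
    by (simp add: char_def mult.commute)
qed

text \<open>Symmetrisation: subtracting an independent copy multiplies the characteristic function
  by its conjugate. This makes the squared modulus itself a characteristic function, so that
  Parseval applies to it.\<close>

lemma (in real_distribution) char_difference:
  "char (distr (M \<Otimes>\<^sub>M M) borel (\<lambda>(x, y). x - y)) t = complex_of_real ((cmod (char M t))\<^sup>2)"
proof -
  interpret pair_prob_space M M ..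
  have int: "integrable (M \<Otimes>\<^sub>M M) (\<lambda>p. iexp (t * (fst p - snd p)))"
    by (rule integrable_const_bound[where B = 1]) auto
  have iexp_diff: "iexp (t * (x - y)) = iexp (t * x) * cnj (iexp (t * y))" for x y
    by (simp add: exp_cnj exp_diff exp_minus right_diff_distrib divide_inverse flip: exp_add)
  have "char (distr (M \<Otimes>\<^sub>M M) borel (\<lambda>(x, y). x - y)) t
      = (CLINT p|(M \<Otimes>\<^sub>M M). iexp (t * (fst p - snd p)))"
    unfolding char_def by (subst integral_distr) (auto simp: split_beta)
  also have "\<dots> = (CLINT x|M. CLINT y|M. iexp (t * (x - y)))"
    using integral_fst'[OF int] by (simp only: fst_conv snd_conv)
  also have "\<dots> = char M t * cnj (char M t)"
    unfolding iexp_diff by (simp add: char_def integral_cnj)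
  also have "\<dots> = complex_of_real ((cmod (char M t))\<^sup>2)"
    by (rule complex_norm_square[symmetric])
  finally show ?thesis .
qed

text \<open>The singularity at 0 is integrable because \<open>s < 1\<close>; beyond 1 the power is
  at most 1 and the Gaussian density dominates.\<close>

lemma integrable_std_normal_powr:
  assumes "0 < s" "s < 1"
  shows "integrable std_normal_distribution (\<lambda>z. \<bar>z\<bar> powr - s)"
proof -
  let ?f = "\<lambda>z::real. std_normal_density z *\<^sub>R \<bar>z\<bar> powr - s"
  have "(\<lambda>z::real. z powr - s) absolutely_integrable_on {0..1}"
    using integrable_on_powr_from_0[of "- s" 1] assms
    by (intro nonnegative_absolutely_integrable_1) auto
  then have "integrable lborel (\<lambda>z. indicat_real {0..1} z *\<^sub>R z powr - s)"
    unfolding set_integrable_def by (subst (asm) integrable_completion) auto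
  then have dom: "integrable lborel (\<lambda>z. indicat_real {0..1} z *\<^sub>R z powr - s + std_normal_density z)"
    using integrable_normal_density[of 1 0] by (intro Bochner_Integration.integrable_add) auto
  have density_le_1: "std_normal_density z \<le> 1" for z
  proof -
    have "1 \<le> sqrt (2 * pi)" using pi_gt3 by (simp add: real_le_rsqrt)
    then show ?thesis
      by (simp add: std_normal_density_def divide_le_eq order_trans[of _ 1])
  qed
  \<comment> \<open>The integrand is even, so a dominating function on the half line is
    enough.\<close>
  have "integrable lborel (\<lambda>z. indicat_real {0..} z *\<^sub>R ?f z)"
  proof (rule Bochner_Integration.integrable_bound[OF dom], measurable, intro AE_I2)
    fix z :: real
    have "std_normal_density z * z powr - s \<le> z powr - s" if "z \<le> 1"
      using density_le_1[of z] by (intro mult_left_le_one_le) auto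
    moreover have "std_normal_density z * z powr - s \<le> std_normal_density z" if "1 < z"
      using that assms powr_mono[of "- s" 0 z] by (intro mult_left_le) auto
    ultimately show "norm (indicat_real {0..} z *\<^sub>R ?f z)
        \<le> norm (indicat_real {0..1} z *\<^sub>R z powr - s + std_normal_density z)"
      by (auto simp: indicator_def add_increasing2 not_le)
  qed
  then have "integrable lborel ?f"
    using has_bochner_integral_even_function[of ?f] by (auto simp: has_bochner_integral_iff std_normal_density_def)
  then show ?thesis
    by (subst integrable_density) auto
qed

section \<open>Average mass of balls under Fourier decay\<close>

lemma (in real_distribution) close_pairs_in_sets:
  "{p. \<bar>fst p - snd p\<bar> \<le> r} \<in> sets (M \<Otimes>\<^sub>M M)"
proof -
  have "{p \<in> space (M \<Otimes>\<^sub>M M). \<bar>fst p - snd p\<bar> \<le> r} \<in> sets (M \<Otimes>\<^sub>M M)"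
    by measurable
  then show ?thesis by (simp add: space_pair_measure)
qed

lemma (in real_distribution) ball_energy_bound:
  assumes "0 < s" "s < 1"
    and decay: "\<And>t. t \<noteq> 0 \<Longrightarrow> (cmod (char M t))\<^sup>2 \<le> C * \<bar>t\<bar> powr - s"
  obtains K where "0 \<le> K"
    "\<And>r. 0 < r \<Longrightarrow> (\<integral>\<^sup>+x. emeasure M (cball x r) \<partial>M) \<le> ennreal (K * r powr s)"
proof -
  let ?N = std_normal_distribution
  interpret N: real_distribution ?N by (rule real_dist_normal_dist)
  interpret MM: pair_prob_space M M ..
  define J where "J = (LINT z|?N. \<bar>z\<bar> powr - s)"
  have C: "0 \<le> C" using order_trans[OF zero_le_power2 decay[of 1]] by simp
  show thesis
  proof
    \<comment> \<open>The factor \<open>exp (1/2)\<close> comes from dominating the indicator of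
      [-1,1] by a Gaussian, and \<open>J\<close> from averaging the decay bound.\<close>
    show "0 \<le> exp (1/2) * C * J" using C by (simp add: J_def)
    fix r :: real assume r: "0 < r"
    \<comment> \<open>For independent X and Y with law \<open>M\<close>, \<open>?D\<close> is the
      law of X - Y and \<open>?E\<close> that of (X - Y)/r. The averaged ball mass is then the
      \<open>?E\<close>-mass of [-1,1].\<close>
    let ?D = "distr (M \<Otimes>\<^sub>M M) borel (\<lambda>(x, y). x - y)"
    let ?E = "distr ?D borel (\<lambda>u. u / r)"
    interpret D: real_distribution ?D
      by (rule MM.real_distribution_distr) (auto simp: split_beta)
    interpret E: real_distribution ?E
      by (rule D.real_distribution_distr) auto
    have charE: "char ?E z = complex_of_real ((cmod (char M (z / r)))\<^sup>2)" for z
    proof -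
      have "char ?E z = char ?D (z / r)"
        unfolding char_def[of ?E] char_def[of ?D]
        by (subst integral_distr[where M = ?D]) auto
      then show ?thesis by (simp only: char_difference)
    qed
    have charN: "char ?N = (\<lambda>t. complex_of_real (exp (- (t\<^sup>2) / 2)))"
      using char_std_normal_distribution by simp
    have gauss_int: "integrable ?E (\<lambda>u. exp (- (u\<^sup>2) / 2))"
      by (rule E.integrable_const_bound[where B = 1]) auto
    have char_int: "integrable ?N (\<lambda>z. (cmod (char M (z / r)))\<^sup>2)"
      using cmod_char_le_1 by (intro N.integrable_const_bound[where B = 1]) (auto intro!: power_le_one)
    have "complex_of_real (LINT u|?E. exp (- (u\<^sup>2) / 2)) = (CLINT u|?E. char ?N u)"
      unfolding charN by simp
    also have "\<dots> = (CLINT z|?N. char ?E z)"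
      by (rule E.char_integral_commute[symmetric]) (rule real_dist_normal_dist)
    also have "\<dots> = complex_of_real (LINT z|?N. (cmod (char M (z / r)))\<^sup>2)"
      unfolding charE by (rule integral_complex_of_real)
    finally have parseval: "(LINT u|?E. exp (- (u\<^sup>2) / 2)) = (LINT z|?N. (cmod (char M (z / r)))\<^sup>2)"
      by (simp only: of_real_eq_iff)
    have "(LINT z|?N. (cmod (char M (z / r)))\<^sup>2) \<le> (LINT z|?N. C * r powr s * \<bar>z\<bar> powr - s)"
    proof (rule integral_mono_AE)
      show "integrable ?N (\<lambda>z. C * r powr s * \<bar>z\<bar> powr - s)"
        using integrable_std_normal_powr[OF assms(1,2)] by simp
      \<comment> \<open>The decay bound is available only away from 0, which is a null set for the
        Gaussian.\<close>
      have "AE z in lborel. (z::real) \<noteq> 0"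
        by (rule AE_lborel_singleton)
      then have "AE z in ?N. z \<noteq> 0"
        by (subst AE_density) (auto elim: eventually_mono)
      then show "AE z in ?N. (cmod (char M (z / r)))\<^sup>2 \<le> C * r powr s * \<bar>z\<bar> powr - s"
      proof eventually_elim
        case (elim z)
        then show ?case
          using decay[of "z / r"] r by (simp add: powr_divide powr_minus field_simps)
      qed
    qed (rule char_int)
    then have bound: "(LINT u|?E. exp (- (u\<^sup>2) / 2)) \<le> C * r powr s * J"
      unfolding parseval J_def by simp
    have "(\<integral>\<^sup>+x. emeasure M (cball x r) \<partial>M) = emeasure (M \<Otimes>\<^sub>M M) {p. \<bar>fst p - snd p\<bar> \<le> r}"
      by (subst emeasure_pair_measure_alt[OF close_pairs_in_sets])
         (simp add: cball_def dist_real_def vimage_def)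
    also have "\<dots> = emeasure ?E {-1..1}"
    proof -
      have "?E = distr (M \<Otimes>\<^sub>M M) borel (\<lambda>p. (fst p - snd p) / r)"
        by (subst distr_distr) (auto simp: comp_def split_beta)
      moreover have "(\<lambda>p. (fst p - snd p) / r) -` {-1..1} \<inter> space (M \<Otimes>\<^sub>M M) = {p. \<bar>fst p - snd p\<bar> \<le> r}"
        using r by (auto simp: space_pair_measure field_simps abs_le_iff)
      ultimately show ?thesis
        by (simp add: emeasure_distr)
    qed
    also have "\<dots> = ennreal (LINT u|?E. indicator {-1..1} u)"
      by (simp add: E.emeasure_eq_measure)
    also have "\<dots> \<le> ennreal (LINT u|?E. exp (1/2) * exp (- (u\<^sup>2) / 2))"
    proof (intro ennreal_leI integral_mono)
      fix u :: real
      have "u\<^sup>2 \<le> 1" if "u \<in> {-1..1}" using that by (auto simp: abs_square_le_1 abs_le_iff)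
      then show "indicator {-1..1} u \<le> exp (1/2) * exp (- (u\<^sup>2) / 2)"
        by (auto simp: indicator_def simp flip: exp_add)
      show "integrable ?E (\<lambda>u. exp (1/2) * exp (- (u\<^sup>2) / 2))"
        using gauss_int by (rule integrable_mult_right)
      show "integrable ?E (indicat_real {-1..1})"
        by (rule E.integrable_const_bound[where B = 1]) auto
    qed
    also have "\<dots> \<le> ennreal (exp (1/2) * C * J * r powr s)"
      using bound by (intro ennreal_leI) (simp add: mult_ac)
    finally show "(\<integral>\<^sup>+x. emeasure M (cball x r) \<partial>M) \<le> ennreal (exp (1/2) * C * J * r powr s)" .
  qed
qed

section \<open>Mass distribution principle\<close>

text \<open>A covering set that meets \<open>E\<close> lies in a ball centred in \<open>E\<close>
  whose radius is its diameter, so its share of the mass of \<open>E\<close> is controlled by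
  \<open>growth\<close>; summing bounds every cover from below. The condition \<open>carrier\<close>
  speaks of measurable supersets of \<open>B\<close> because a projection of a Borel set need not be
  Borel.\<close>

lemma mass_distribution_principle:
  fixes M :: "'a::metric_space measure"
  assumes sets_M: "sets M = sets borel"
    and E: "E \<in> sets M" "0 < emeasure M E"
    and c: "0 < c" and t: "0 < t"
    and growth: "\<And>x r. x \<in> E \<Longrightarrow> 0 \<le> r \<Longrightarrow> r \<le> 1 \<Longrightarrow> emeasure M (cball x r) \<le> ennreal (c * r powr t)"
    and carrier: "\<And>F. F \<in> sets M \<Longrightarrow> B \<subseteq> F \<Longrightarrow> emeasure M (E - F) = 0"
  shows "ereal t \<le> hausdorff_dim B"
  unfolding hausdorff_dim_def
proof (rule INF_greatest, clarsimp)
  fix s :: real assume s: "0 \<le> s" and null: "hausdorff_measure s B = 0"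
  \<comment> \<open>Closures are measurable and have the same diameter as the covering sets. The
    diameter may be 0, which is why \<open>growth\<close> includes radius 0.\<close>
  have piece: "emeasure M (E \<inter> closure U) \<le> ennreal c * diam_powr s U"
    if "s < t" "bounded U" "diameter U \<le> 1" for U
  proof (cases "E \<inter> closure U = {}")
    case False
    then obtain x where x: "x \<in> E" "x \<in> closure U" by blast
    have diam: "0 \<le> diameter U" using that by (intro diameter_ge_0)
    have "closure U \<subseteq> cball x (diameter U)"
      using diameter_bounded_bound[of "closure U" x] diameter_closure[OF that(2)] x that(2)
      by (auto simp: bounded_closure)
    then have "emeasure M (E \<inter> closure U) \<le> emeasure M (cball x (diameter U))"
      by (intro emeasure_mono) (auto simp: sets_M)
    also have "\<dots> \<le> ennreal c * ennreal (diameter U powr t)"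
      using growth[OF x(1) diam that(3)] c by (simp add: ennreal_mult')
    also have "\<dots> \<le> ennreal c * diam_powr s U"
    proof (rule mult_left_mono)
      have "U \<noteq> {}" using x by auto
      \<comment> \<open>This bound serves the case \<open>s = 0\<close>, where
        \<open>diam_powr\<close> is 1; the next one serves \<open>s > 0\<close>. Both use diameter
        at most 1.\<close>
      moreover have "diameter U powr t \<le> 1"
        using diam that t by (intro powr_le1) auto
      moreover have "diameter U powr t \<le> diameter U powr s"
        using diam that by (intro powr_mono') auto
      ultimately show "ennreal (diameter U powr t) \<le> diam_powr s U"
        by (auto simp: diam_powr_def ennreal_leI simp flip: ennreal_1)
    qed simp
    finally show ?thesis .
  qed simp
  show "t \<le> s"
  proof (rule ccontr)
    assume "\<not> t \<le> s"
    then have st: "s < t" by simp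
    \<comment> \<open>Scale 1 suffices, since the measure is a supremum over scales and
      \<open>piece\<close> covers all diameters up to 1.\<close>
    have "emeasure M E / ennreal c \<le> hausdorff_content s 1 B"
      unfolding hausdorff_content_def
    proof (rule INF_greatest, clarify)
      fix U :: "nat \<Rightarrow> 'a set"
      assume cover: "B \<subseteq> (\<Union>i. U i)" and U: "\<forall>i. bounded (U i) \<and> diameter (U i) \<le> 1"
      define F where "F = (\<Union>i. closure (U i))"
      have "F \<in> sets M"
        unfolding F_def sets_M by (intro sets.countable_UN) auto
      moreover have "B \<subseteq> F"
        unfolding F_def using cover by (rule order_trans) (intro UN_mono order_refl closure_subset)
      ultimately have E_minus_F: "emeasure M (E - F) = 0" and F: "F \<in> sets M"
        by (auto intro: carrier)
      have "emeasure M E = emeasure M (E \<inter> F) + emeasure M (E - F)"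
        using E F by (subst plus_emeasure) (auto intro: arg_cong[where f = "emeasure M"])
      also have "\<dots> = emeasure M (\<Union>i. E \<inter> closure (U i))"
        using E_minus_F by (simp add: F_def)
      also have "\<dots> \<le> (\<Sum>i. emeasure M (E \<inter> closure (U i)))"
        using E by (intro emeasure_subadditive_countably) (auto simp: sets_M)
      also have "\<dots> \<le> (\<Sum>i. ennreal c * diam_powr s (U i))"
        using piece[OF st] U by (intro suminf_le) auto
      also have "\<dots> = ennreal c * (\<Sum>i. diam_powr s (U i))"
        by simp
      finally show "emeasure M E / ennreal c \<le> (\<Sum>i. diam_powr s (U i))"
        using c by (intro divide_le_posI_ennreal) auto
    qed
    also have "\<dots> \<le> hausdorff_measure s B"
      unfolding hausdorff_measure_def by (rule SUP_upper) simp
    finally show False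
      using E null by (simp add: ennreal_divide_eq_0_iff)
  qed
qed

section \<open>From average to pointwise ball growth\<close>

text \<open>Weighting the masses of dyadic balls by \<open>h k powr - t\<close> gives a sum
  \<open>G\<close> whose integral is at most a geometric series with ratio \<open>q < 1\<close>.
  Where \<open>G\<close> is at most \<open>b\<close>, so is each of its terms, which is the growth
  bound at dyadic radii.\<close>

lemma (in real_distribution) regular_subset_of_ball_energy:
  assumes t: "0 < t" "t < s" and K: "0 \<le> K"
    and energy: "\<And>r. 0 < r \<Longrightarrow> (\<integral>\<^sup>+x. emeasure M (cball x r) \<partial>M) \<le> ennreal (K * r powr s)"
  obtains E c where "E \<in> sets M" "0 < emeasure M E" "0 < c"
    "\<And>x r. x \<in> E \<Longrightarrow> 0 \<le> r \<Longrightarrow> r \<le> 1 \<Longrightarrow> emeasure M (cball x r) \<le> ennreal (c * r powr t)"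
proof -
  have cball_measurable [measurable]: "(\<lambda>x. emeasure M (cball x r)) \<in> borel_measurable M" for r
    using measurable_emeasure_Pair[OF close_pairs_in_sets]
    by (simp add: cball_def dist_real_def vimage_def)
  define q :: real where "q = (1/2) powr (s - t)"
  have q: "0 < q" "q < 1"
    using t powr_less_mono'[of "1/2" 0 "s - t"] by (auto simp: q_def)
  define h :: "nat \<Rightarrow> real" where "h k = (1/2) ^ k" for k
  have h: "0 < h k" for k by (simp add: h_def)
  define G where "G x = (\<Sum>k. ennreal (h k powr - t) * emeasure M (cball x (h k)))" for x
  have [measurable]: "G \<in> borel_measurable M"
    unfolding G_def by measurable
  have "(\<integral>\<^sup>+x. G x \<partial>M) = (\<Sum>k. ennreal (h k powr - t) * (\<integral>\<^sup>+x. emeasure M (cball x (h k)) \<partial>M))"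
    unfolding G_def by (simp add: nn_integral_suminf nn_integral_cmult)
  also have "\<dots> \<le> (\<Sum>k. ennreal (K * q ^ k))"
  proof (intro suminf_le)
    fix k
    have "ennreal (h k powr - t) * (\<integral>\<^sup>+x. emeasure M (cball x (h k)) \<partial>M)
        \<le> ennreal (h k powr - t) * ennreal (K * h k powr s)"
      using energy[OF h] by (intro mult_left_mono) auto
    also have "\<dots> = ennreal (K * h k powr (s - t))"
      by (simp add: powr_diff powr_minus divide_inverse mult_ac flip: ennreal_mult')
    also have "h k powr (s - t) = q ^ k"
      by (simp add: h_def q_def powr_powr mult.commute flip: powr_realpow)
    finally show "ennreal (h k powr - t) * (\<integral>\<^sup>+x. emeasure M (cball x (h k)) \<partial>M) \<le> ennreal (K * q ^ k)" .
  qed auto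
  also have "\<dots> = ennreal (K * (1 / (1 - q)))"
    using K q by (intro suminf_ennreal_eq sums_mult geometric_sums) auto
  finally have G_integral: "(\<integral>\<^sup>+x. G x \<partial>M) \<le> ennreal (K * (1 / (1 - q)))" .
  \<comment> \<open>The added 1 puts \<open>b\<close> strictly above the integral of
    \<open>G\<close>. As \<open>M\<close> has total mass 1, \<open>G\<close> cannot be at least
    \<open>b\<close> almost everywhere.\<close>
  define b where "b = K * (1 / (1 - q)) + 1"
  have b: "0 < b" using K q by (auto simp: b_def intro: add_nonneg_pos)
  define E where "E = {x. G x \<le> ennreal b}"
  have E_sets: "E \<in> sets M"
  proof -
    have "{x \<in> space M. G x \<le> ennreal b} \<in> sets M" by measurable
    then show ?thesis by (simp add: E_def)
  qed
  have E_pos: "0 < emeasure M E"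
  proof (rule ccontr)
    assume "\<not> 0 < emeasure M E"
    then have "E \<in> null_sets M" using E_sets by (simp add: null_sets_def)
    then have "AE x in M. x \<notin> E"
      by (rule AE_not_in)
    then have "AE x in M. ennreal b \<le> G x"
      by eventually_elim (simp add: E_def)
    from nn_integral_mono_AE[OF this] have "ennreal b \<le> (\<integral>\<^sup>+x. G x \<partial>M)"
      by (simp add: emeasure_space_1[simplified])
    also note G_integral
    finally show False using K q by (simp add: b_def ennreal_le_iff)
  qed
  have dyadic: "emeasure M (cball x (h k)) \<le> ennreal (b * h k powr t)" if "x \<in> E" for x k
  proof -
    have "ennreal (h k powr - t) * emeasure M (cball x (h k)) \<le> G x"
      unfolding G_def using sum_le_suminf[of "\<lambda>k. ennreal (h k powr - t) * emeasure M (cball x (h k))" "{k}"]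
      by simp
    also have "\<dots> \<le> ennreal b" using that by (simp add: E_def)
    finally have "ennreal (h k powr t) * (ennreal (h k powr - t) * emeasure M (cball x (h k)))
        \<le> ennreal (h k powr t) * ennreal b"
      by (rule mult_left_mono) simp
    moreover have "ennreal (h k powr t) * (ennreal (h k powr - t) * e) = e" for e
      using h[of k] by (simp add: powr_minus flip: mult.assoc ennreal_mult')
    ultimately show ?thesis using b by (simp add: mult.commute flip: ennreal_mult')
  qed
  have pos_radius: "emeasure M (cball x r) \<le> ennreal (b * 2 powr t * r powr t)"
    if x: "x \<in> E" and r: "0 < r" "r \<le> 1" for x r
  proof -
    obtain n where n: "h n < r"
      using real_arch_pow_inv[OF r(1), of "1/2"] by (auto simp: h_def)
    \<comment> \<open>Since \<open>h 0 = 1\<close> and \<open>r \<le> 1\<close>, the least index is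
      positive. Its predecessor \<open>k\<close> satisfies \<open>r \<le> h k < 2 * r\<close>, at
      the cost of a factor \<open>2 powr t\<close>.\<close>
    define m where "m = (LEAST n. h n < r)"
    have m: "h m < r" unfolding m_def using n by (rule LeastI)
    have "m \<noteq> 0" using m r by (intro notI) (simp add: h_def)
    then obtain k where k: "m = Suc k" by (cases m) auto
    have "r \<le> h k"
      using not_less_Least[of k "\<lambda>n. h n < r"] k unfolding m_def[symmetric] by simp
    then have "emeasure M (cball x r) \<le> emeasure M (cball x (h k))"
      by (intro emeasure_mono) auto
    also have "\<dots> \<le> ennreal (b * h k powr t)" by (rule dyadic[OF x])
    also have "\<dots> \<le> ennreal (b * (2 * r) powr t)"
      using m k b h[of k] t by (intro ennreal_leI mult_left_mono powr_mono2) (auto simp: h_def)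
    finally show ?thesis
      using r by (simp add: powr_mult mult_ac)
  qed
  show thesis
  proof (rule that[OF E_sets E_pos])
    show "0 < b * 2 powr t" using b by simp
    fix x r :: real assume x: "x \<in> E" and r: "0 \<le> r" "r \<le> 1"
    show "emeasure M (cball x r) \<le> ennreal (b * 2 powr t * r powr t)"
    proof (cases "r = 0")
      case True
      \<comment> \<open>At radius 0 the claimed bound is 0, so points of \<open>E\<close> must have
        no mass; this follows by shrinking dyadic balls.\<close>
      have "h \<longlonglongrightarrow> 0"
        unfolding h_def by (rule LIMSEQ_realpow_zero) auto
      then have "(\<lambda>k. h k powr t) \<longlonglongrightarrow> 0"
        by (rule tendsto_zero_powrI[OF _ tendsto_const _ t(1)])
           (simp add: h less_imp_le)
      from tendsto_mult_right_zero[OF this, of b]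
      have "(\<lambda>k. ennreal (b * h k powr t)) \<longlonglongrightarrow> ennreal 0"
        by (rule tendsto_ennrealI)
      moreover have "emeasure M (cball x 0) \<le> ennreal (b * h k powr t)" for k
      proof -
        have "emeasure M (cball x 0) \<le> emeasure M (cball x (h k))"
          using h[of k] by (intro emeasure_mono) auto
        also note dyadic[OF x]
        finally show ?thesis .
      qed
      ultimately have "emeasure M (cball x 0) \<le> ennreal 0"
        by (intro LIMSEQ_le_const) auto
      then show ?thesis using True by simp
    next
      case False
      then show ?thesis using pos_radius[OF x, of r] r by simp
    qed
  qed
qed

section \<open>Projections and Fourier dimension\<close>

text \<open>The characteristic function of the projected measure is the Fourier transform of the
  original one restricted to the line through \<open>v\<close>, so it inherits the decay.\<close>

lemma hausdorff_dim_projection_ge: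
  fixes A :: "'a::euclidean_space set"
  assumes "v \<noteq> 0" and t: "0 < t" "t < 1" "ereal t < fourier_dim A"
  shows "ereal t \<le> hausdorff_dim ((\<lambda>y. v \<bullet> y) ` A)"
proof -
  obtain s' \<mu> C where s': "t < s'" and \<mu>: "\<mu> \<in> prob_measures_on A"
    and decay: "\<And>\<xi>. \<xi> \<noteq> 0 \<Longrightarrow> cmod (fourier_transform \<mu> \<xi>) \<le> C * norm \<xi> powr (- s' / 2)"
    using t(3) unfolding fourier_dim_def less_SUP_iff by auto
  from \<mu> have sets_\<mu> [measurable_cong]: "sets \<mu> = sets borel"
    and "prob_space \<mu>" and carrier: "emeasure \<mu> A = 1"
    by (auto simp: prob_measures_on_def)
  interpret \<mu>: prob_space \<mu> by fact
  have space_\<mu>: "space \<mu> = UNIV"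
    using sets_eq_imp_space_eq[OF sets_\<mu>] by simp
  define \<nu> where "\<nu> = distr \<mu> borel (\<lambda>y. v \<bullet> y)"
  interpret \<nu>: real_distribution \<nu>
    unfolding \<nu>_def by (rule \<mu>.real_distribution_distr) measurable
  \<comment> \<open>The exponent must lie below 1 for the Gaussian moment and above \<open>t\<close>
    for the geometric series.\<close>
  define s where "s = (t + min s' 1) / 2"
  have s: "t < s" "s < 1" "s \<le> s'" using s' t by (auto simp: s_def)
  define w where "w = norm v / (2 * pi)"
  have w: "0 < w" using \<open>v \<noteq> 0\<close> by (simp add: w_def)
  \<comment> \<open>The sign and the factor 2 pi reconcile the two conventions for the
    exponential.\<close>
  have char_\<nu>: "char \<nu> \<tau> = fourier_transform \<mu> (- (\<tau> / (2 * pi)) *\<^sub>R v)" for \<tau>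
    unfolding char_def \<nu>_def fourier_transform_def
    by (subst integral_distr) (auto simp: mult_ac intro!: Bochner_Integration.integral_cong)
  \<comment> \<open>Lowering the exponent from \<open>s'\<close> to \<open>s\<close> is harmless
    only for large frequencies. For small ones the trivial bound 1 suffices, whence the
    maximum.\<close>
  have "(cmod (char \<nu> \<tau>))\<^sup>2 \<le> max 1 (C\<^sup>2 * w powr - s') * \<bar>\<tau>\<bar> powr - s" if "\<tau> \<noteq> 0" for \<tau>
  proof (cases "\<bar>\<tau>\<bar> \<le> 1")
    case True
    have "(cmod (char \<nu> \<tau>))\<^sup>2 \<le> 1" by (simp add: power_le_one \<nu>.cmod_char_le_1)
    also have "1 \<le> \<bar>\<tau>\<bar> powr - s"
      using powr_mono'[of "- s" 0 "\<bar>\<tau>\<bar>"] True that s t by simp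
    also have "\<dots> \<le> max 1 (C\<^sup>2 * w powr - s') * \<bar>\<tau>\<bar> powr - s"
      using mult_right_mono[of 1 "max 1 (C\<^sup>2 * w powr - s')" "\<bar>\<tau>\<bar> powr - s"] by simp
    finally show ?thesis .
  next
    case False
    have "norm (- (\<tau> / (2 * pi)) *\<^sub>R v) = w * \<bar>\<tau>\<bar>"
      by (simp add: w_def)
    then have "cmod (char \<nu> \<tau>) \<le> C * (w * \<bar>\<tau>\<bar>) powr (- s' / 2)"
      using decay[of "- (\<tau> / (2 * pi)) *\<^sub>R v"] that \<open>v \<noteq> 0\<close> by (simp add: char_\<nu>)
    then have "(cmod (char \<nu> \<tau>))\<^sup>2 \<le> (C * (w * \<bar>\<tau>\<bar>) powr (- s' / 2))\<^sup>2"
      by (intro power_mono) auto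
    also have "\<dots> = C\<^sup>2 * (w * \<bar>\<tau>\<bar>) powr - s'"
      by (simp add: power_mult_distrib power2_eq_square[of "_ powr _"] flip: powr_add)
    also have "\<dots> = C\<^sup>2 * w powr - s' * \<bar>\<tau>\<bar> powr - s'"
      using w by (simp add: powr_mult mult.assoc)
    also have "\<dots> \<le> max 1 (C\<^sup>2 * w powr - s') * \<bar>\<tau>\<bar> powr - s"
      using False s by (intro mult_mono powr_mono) auto
    finally show ?thesis .
  qed
  then obtain K where "0 \<le> K"
    "\<And>r. 0 < r \<Longrightarrow> (\<integral>\<^sup>+x. emeasure \<nu> (cball x r) \<partial>\<nu>) \<le> ennreal (K * r powr s)"
    using \<nu>.ball_energy_bound[of s] s t by (metis order.strict_trans)
  then obtain E c where E: "E \<in> sets \<nu>" "0 < emeasure \<nu> E" "0 < c"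
    "\<And>x r. x \<in> E \<Longrightarrow> 0 \<le> r \<Longrightarrow> r \<le> 1 \<Longrightarrow> emeasure \<nu> (cball x r) \<le> ennreal (c * r powr t)"
    using \<nu>.regular_subset_of_ball_energy[OF t(1) s(1)] by metis
  show ?thesis
  proof (rule mass_distribution_principle[OF _ E(1-3) t(1) E(4)])
    show "emeasure \<nu> (E - F) = 0" if F: "F \<in> sets \<nu>" "(\<lambda>y. v \<bullet> y) ` A \<subseteq> F" for F
    proof -
      \<comment> \<open>The preimage of \<open>F\<close> contains \<open>A\<close>, so
        \<open>F\<close> has full mass under the projected measure.\<close>
      have "1 \<le> emeasure \<mu> ((\<lambda>y. v \<bullet> y) -` F \<inter> space \<mu>)"
        unfolding carrier[symmetric]
      proof (rule emeasure_mono)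
        show "(\<lambda>y. v \<bullet> y) -` F \<inter> space \<mu> \<in> sets \<mu>"
          using F(1) by (intro measurable_sets[of _ \<mu> borel]) auto
      qed (use F(2) in \<open>auto simp: space_\<mu>\<close>)
      also have "\<dots> = emeasure \<nu> F"
        using F by (simp add: \<nu>_def emeasure_distr)
      finally have "emeasure \<nu> F = 1"
        using \<nu>.emeasure_le_1[of F] by (rule order.antisym[rotated])
      then have "AE x in \<nu>. x \<in> F"
        using F(1) by (simp add: \<nu>.AE_in_set_eq_1 \<nu>.emeasure_eq_measure)
      then have "AE x in \<nu>. x \<notin> E - F" by eventually_elim simp
      then show ?thesis
        using E(1) F(1) by (subst (asm) AE_iff_measurable[OF _ refl]) (auto simp: set_diff_eq)
    qed
  qed simp_all
qed

theorem proposition1p4: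
  fixes A :: "(real ^ 'n) set" and u :: real
  assumes "A \<in> sets borel"
    and "hausdorff_dim A > 1"
    and "0 < u" and "u \<le> 1"
    and "fourier_dim A \<ge> ereal u"
  shows "\<forall>a x :: real ^ 'n. x \<noteq> a \<longrightarrow> hausdorff_dim (Pi_proj a x A) \<ge> ereal u"
proof (intro allI impI)
  fix a x :: "real ^ 'n"
  assume "x \<noteq> a"
  \<comment> \<open>The supremum in \<open>fourier_dim\<close> need not be attained, so the bound is
    proved for each \<open>t\<close> strictly below \<open>u\<close> and then passes to the
    limit.\<close>
  have "ereal t \<le> hausdorff_dim (Pi_proj a x A)" if "0 < t" "t < u" for t
  proof -
    have "ereal t < fourier_dim A"
      using less_le_trans[of "ereal t" "ereal u"] that assms(5) by simp
    moreover have "Pi_proj a x A = (\<lambda>y. (a - x) \<bullet> y) ` A"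
      by (auto simp: Pi_proj_def)
    ultimately show ?thesis
      using hausdorff_dim_projection_ge[of "a - x" t A] that assms(4) \<open>x \<noteq> a\<close> by simp
  qed
  then show "ereal u \<le> hausdorff_dim (Pi_proj a x A)"
    using assms(3) by (intro dense_le_bounded[of 0 "ereal u"]) (auto simp: ereal_less_ereal_Ex)
qed

end
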